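(* (i) For every horizon $|T|\ge 2$, there is a static profile with two voters and three candidates, single-peaked with respect to a common axis (the same in all rounds), for which no sequence $W$ satisfies fixed-rank-wEJR. Hence, for each of the six axioms fixed-rank-EJR, rank-EJR, all-rank-EJR, fixed-rank-wEJR, rank-wEJR, all-rank-wEJR, there is a profile for which no sequence satisfies it. (ii) On (complete) profiles with at most two candidates, a sequence satisfies rank-wEJR if and only if it satisfies rank-wPJR, and it satisfies fixed-rank-wEJR if and only if it satisfies fixed-rank-wPJR. Both equivalences also hold when the axioms are applied to any fixed interval of rounds. (iii) For every horizon $|T|\ge 2$, there is a static strict one-dimensional Euclidean profile with two voters and two candidates for which no sequence satisfies all-rank-wEJR.
   Context: Model. Voters $V=[n]$, a set $C$ of $m$ candidates, rounds $T=\{1,\dots,|T|\}$ with $n,m,|T|\ge 1$; $|T|$ is the horizon. In each round $j$ each voter $i$ has a strict complete ranking $\succ_i^j$ of $C$; together these form the profile, which is static if the rankings are the same in all rounds. A sequence is $W=(w^1,\dots,w^{|T|})\in C^{|T|}$; $w^j$ is the winner of round $j$. A group is a nonempty $S\subseteq V$. Let $\mathrm{rank}_i^j(c)=|\{c':c'\succ_i^j c\}|+1$ and, for $r\in[m]$, $A_i^j(r)=\{c:\mathrm{rank}_i^j(c)\le r\}$. Cutoffs. Fixed-rank: a single $r\in[m]$, voter $i$ approves $A_i^j(r)$ in every round $j$. Rank: a rank vector $\mathbf r\in[m]^{|T|}$, voter $i$ approves $A_i^j(r^j)$ in round $j$. All-rank: a rank matrix $R=(r_i^j)\in[m]^{|T|\times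 n}$, voter $i$ approves $A_i^j(r_i^j)$ in round $j$. Under given cutoffs, $S$ agrees in round $j$ if its members approve a common candidate in round $j$, and is represented in round $j$ if some member approves $w^j$. Axioms. For given cutoffs: EJR (resp. PJR) requires that for every positive integer $\ell$ and every group $S$ that agrees in $k>0$ rounds and satisfies $|S|\ge \ell n/k$, some voter $i\in S$ approves the winner in at least $\ell$ rounds (resp. $S$ is represented in at least $\ell$ rounds). wEJR and wPJR impose this only for groups agreeing in every round ($k=|T|$). For an axiom $X$, $W$ satisfies fixed-rank-$X$ (rank-$X$, all-rank-$X$) if it satisfies $X$ for every $r\in[m]$ (every rank vector, every rank matrix). Applying an axiom to a contiguous interval $I\subseteq T$ means using only the rounds in $I$, with $|I|$ as the horizon, and counting agreement, approvals of winners and representation only within $I$. Domains. Rankings in a round are single-peaked with respect to a linear order (axis) of $C$ if, for every voter, candidates are ranked lower as one moves away from her first choice along the axis in either direction. A profile is strict one-dimensional Euclidean if, in each round, voters and candidates can be placed on the real line so that every voter ranks candidates by increasing distance, with no ties in distance. *)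

theory Defs
  imports Complex_Main
begin

text \<open>
  Voters are the numbers \<open>1, \<dots>, n\<close>, rounds the numbers \<open>1, \<dots>, T\<close>, and candidates the elements of
  a finite set \<open>C\<close>.  A profile maps round \<open>j\<close> and voter \<open>i\<close> to a strict preference relation:
  \<open>P j i c d\<close> reads ``in round \<open>j\<close> voter \<open>i\<close> strictly prefers \<open>c\<close> to \<open>d\<close>''.  Values of relations,
  profiles, sequences and cutoffs outside the relevant index and candidate sets are irrelevant.
\<close>

type_synonym 'c profile = "nat \<Rightarrow> nat \<Rightarrow> 'c \<Rightarrow> 'c \<Rightarrow> bool"

definition strict_ranking :: "'c set \<Rightarrow> ('c \<Rightarrow> 'c \<Rightarrow> bool) \<Rightarrow> bool" where
  "strict_ranking C R \<longleftrightarrow> irreflp_on C R \<and> transp_on C R \<and> totalp_on C R"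

definition is_profile :: "nat \<Rightarrow> 'c set \<Rightarrow> nat \<Rightarrow> 'c profile \<Rightarrow> bool" where
  "is_profile n C T P \<longleftrightarrow>
     n \<ge> 1 \<and> finite C \<and> card C \<ge> 1 \<and> T \<ge> 1 \<and>
     (\<forall>j\<in>{1..T}. \<forall>i\<in>{1..n}. strict_ranking C (P j i))"

definition static_profile :: "nat \<Rightarrow> 'c set \<Rightarrow> nat \<Rightarrow> 'c profile \<Rightarrow> bool" where
  "static_profile n C T P \<longleftrightarrow>
     (\<forall>j\<in>{1..T}. \<forall>j'\<in>{1..T}. \<forall>i\<in>{1..n}. \<forall>c\<in>C. \<forall>d\<in>C. P j i c d \<longleftrightarrow> P j' i c d)"

definition winner_sequence :: "'c set \<Rightarrow> nat \<Rightarrow> (nat \<Rightarrow> 'c) \<Rightarrow> bool" where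
  "winner_sequence C T W \<longleftrightarrow> (\<forall>j\<in>{1..T}. W j \<in> C)"

definition cand_rank :: "'c set \<Rightarrow> ('c \<Rightarrow> 'c \<Rightarrow> bool) \<Rightarrow> 'c \<Rightarrow> nat" where
  "cand_rank C R c = card {c'\<in>C. R c' c} + 1"

definition top_cands :: "'c set \<Rightarrow> ('c \<Rightarrow> 'c \<Rightarrow> bool) \<Rightarrow> nat \<Rightarrow> 'c set" where
  "top_cands C R r = {c\<in>C. cand_rank C R c \<le> r}"


text \<open>
  The axioms are stated for approval sets \<open>A j i\<close> (round \<open>j\<close>, voter \<open>i\<close>) and a set \<open>I\<close> of rounds:
  only the rounds in \<open>I\<close> count and the horizon is \<open>card I\<close>.  The unrestricted axioms are the case
  \<open>I = {1..T}\<close>.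
\<close>

definition is_group :: "nat \<Rightarrow> nat set \<Rightarrow> bool" where
  "is_group n S \<longleftrightarrow> S \<noteq> {} \<and> S \<subseteq> {1..n}"

definition agreement_rounds ::
  "'c set \<Rightarrow> nat set \<Rightarrow> (nat \<Rightarrow> nat \<Rightarrow> 'c set) \<Rightarrow> nat set \<Rightarrow> nat set" where
  "agreement_rounds C I A S = {j\<in>I. \<exists>c\<in>C. \<forall>i\<in>S. c \<in> A j i}"

definition approved_rounds ::
  "nat set \<Rightarrow> (nat \<Rightarrow> nat \<Rightarrow> 'c set) \<Rightarrow> (nat \<Rightarrow> 'c) \<Rightarrow> nat \<Rightarrow> nat set" where
  "approved_rounds I A W i = {j\<in>I. W j \<in> A j i}"

definition represented_rounds ::
  "nat set \<Rightarrow> (nat \<Rightarrow> nat \<Rightarrow> 'c set) \<Rightarrow> (nat \<Rightarrow> 'c) \<Rightarrow> nat set \<Rightarrow> nat set" where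
  "represented_rounds I A W S = {j\<in>I. \<exists>i\<in>S. W j \<in> A j i}"

type_synonym 'c jr_axiom =
  "nat \<Rightarrow> 'c set \<Rightarrow> nat set \<Rightarrow> (nat \<Rightarrow> nat \<Rightarrow> 'c set) \<Rightarrow> (nat \<Rightarrow> 'c) \<Rightarrow> bool"

definition EJR :: "'c jr_axiom" where
  "EJR n C I A W \<longleftrightarrow>
     (\<forall>l::nat. \<forall>S. \<forall>k. l > 0 \<and> is_group n S \<and> k = card (agreement_rounds C I A S) \<and> k > 0 \<and>
        real (card S) \<ge> real l * real n / real k \<longrightarrow>
        (\<exists>i\<in>S. card (approved_rounds I A W i) \<ge> l))"

definition wEJR :: "'c jr_axiom" where
  "wEJR n C I A W \<longleftrightarrow>
     (\<forall>l::nat. \<forall>S. l > 0 \<and> is_group n S \<and> agreement_rounds C I A S = I \<and> card I > 0 \<and>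
        real (card S) \<ge> real l * real n / real (card I) \<longrightarrow>
        (\<exists>i\<in>S. card (approved_rounds I A W i) \<ge> l))"

definition wPJR :: "'c jr_axiom" where
  "wPJR n C I A W \<longleftrightarrow>
     (\<forall>l::nat. \<forall>S. l > 0 \<and> is_group n S \<and> agreement_rounds C I A S = I \<and> card I > 0 \<and>
        real (card S) \<ge> real l * real n / real (card I) \<longrightarrow>
        card (represented_rounds I A W S) \<ge> l)"

definition fixed_rank ::
  "'c jr_axiom \<Rightarrow> nat \<Rightarrow> 'c set \<Rightarrow> 'c profile \<Rightarrow> nat set \<Rightarrow> (nat \<Rightarrow> 'c) \<Rightarrow> bool" where
  "fixed_rank X n C P I W \<longleftrightarrow>
     (\<forall>r\<in>{1..card C}. X n C I (\<lambda>j i. top_cands C (P j i) r) W)"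

definition rank_vector ::
  "'c jr_axiom \<Rightarrow> nat \<Rightarrow> 'c set \<Rightarrow> 'c profile \<Rightarrow> nat set \<Rightarrow> (nat \<Rightarrow> 'c) \<Rightarrow> bool" where
  "rank_vector X n C P I W \<longleftrightarrow>
     (\<forall>r::nat \<Rightarrow> nat. (\<forall>j\<in>I. r j \<in> {1..card C}) \<longrightarrow>
        X n C I (\<lambda>j i. top_cands C (P j i) (r j)) W)"

definition all_rank ::
  "'c jr_axiom \<Rightarrow> nat \<Rightarrow> 'c set \<Rightarrow> 'c profile \<Rightarrow> nat set \<Rightarrow> (nat \<Rightarrow> 'c) \<Rightarrow> bool" where
  "all_rank X n C P I W \<longleftrightarrow>
     (\<forall>R::nat \<Rightarrow> nat \<Rightarrow> nat. (\<forall>j\<in>I. \<forall>i\<in>{1..n}. R j i \<in> {1..card C}) \<longrightarrow>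
        X n C I (\<lambda>j i. top_cands C (P j i) (R j i)) W)"


text \<open>The axis is a strict linear order \<open>L\<close>; \<open>p\<close> is the voter's first choice.\<close>

definition single_peaked_on :: "'c set \<Rightarrow> ('c \<Rightarrow> 'c \<Rightarrow> bool) \<Rightarrow> ('c \<Rightarrow> 'c \<Rightarrow> bool) \<Rightarrow> bool" where
  "single_peaked_on C L R \<longleftrightarrow>
     (\<exists>p\<in>C. (\<forall>c\<in>C. c \<noteq> p \<longrightarrow> R p c) \<and>
        (\<forall>c\<in>C. \<forall>d\<in>C. L c d \<and> (L d p \<or> d = p) \<longrightarrow> R d c) \<and>
        (\<forall>c\<in>C. \<forall>d\<in>C. (L p c \<or> c = p) \<and> L c d \<longrightarrow> R c d))"

definition common_axis_single_peaked :: "nat \<Rightarrow> 'c set \<Rightarrow> nat \<Rightarrow> 'c profile \<Rightarrow> bool" where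
  "common_axis_single_peaked n C T P \<longleftrightarrow>
     (\<exists>L. strict_ranking C L \<and> (\<forall>j\<in>{1..T}. \<forall>i\<in>{1..n}. single_peaked_on C L (P j i)))"

definition strict_euclidean :: "nat \<Rightarrow> 'c set \<Rightarrow> nat \<Rightarrow> 'c profile \<Rightarrow> bool" where
  "strict_euclidean n C T P \<longleftrightarrow>
     (\<forall>j\<in>{1..T}. \<exists>(x::nat \<Rightarrow> real) (y::'c \<Rightarrow> real). \<forall>i\<in>{1..n}. \<forall>c\<in>C. \<forall>d\<in>C.
        (c \<noteq> d \<longrightarrow> \<bar>x i - y c\<bar> \<noteq> \<bar>x i - y d\<bar>) \<and>
        (P j i c d \<longleftrightarrow> \<bar>x i - y c\<bar> < \<bar>x i - y d\<bar>))"

end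

theory Submission
  imports Defs
begin

text \<open>
  With two voters of opposite rankings, rank one forces each voter's favourite to win at least once.
  In (i), rank two makes the two voters agree on the middle candidate, so one of them must approve
  every winner, which excludes the favourite of the other.  In (iii), in each round the voter whose
  favourite loses gets cutoff one and the other voter cutoff two: they agree in every round, yet
  each of them disapproves some winner.  In (ii), with two candidates and a cutoff depending on the
  round only, voters who approve a common candidate approve the same set, so an agreeing group
  behaves like a single voter.
\<close>

section \<open>Equivalence of wEJR and wPJR with at most two candidates\<close>

lemma wEJR_imp_wPJR:
  assumes "finite I" "wEJR n C I A W"
  shows "wPJR n C I A W"
  unfolding wPJR_def
proof (intro allI impI)
  fix l :: nat and S
  assume S: "l > 0 \<and> is_group n S \<and> agreement_rounds C I A S = I \<and> card I > 0 \<and>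
    real (card S) \<ge> real l * real n / real (card I)"
  with assms(2) obtain i where "i \<in> S" "card (approved_rounds I A W i) \<ge> l"
    unfolding wEJR_def by blast
  moreover have "card (approved_rounds I A W i) \<le> card (represented_rounds I A W S)"
    using assms(1) \<open>i \<in> S\<close>
    by (intro card_mono) (auto simp: approved_rounds_def represented_rounds_def)
  ultimately show "card (represented_rounds I A W S) \<ge> l" by linarith
qed

text \<open>By \<open>eq\<close>, approval sets within a round are equal or disjoint. The members of
  a group agreeing in every round therefore share one approval set per round, and the group is
  represented exactly when any one member approves the winner.\<close>

lemma wPJR_imp_wEJR:
  assumes eq: "\<And>j i i' c. \<lbrakk>j \<in> I; i \<in> {1..n}; i' \<in> {1..n}; c \<in> A j i; c \<in> A j i'\<rbrakk> \<Longrightarrow> A j i = A j i'"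
    and "wPJR n C I A W"
  shows "wEJR n C I A W"
  unfolding wEJR_def
proof (intro allI impI)
  fix l :: nat and S
  assume S: "l > 0 \<and> is_group n S \<and> agreement_rounds C I A S = I \<and> card I > 0 \<and>
    real (card S) \<ge> real l * real n / real (card I)"
  then obtain i where i: "i \<in> S" and sub: "S \<subseteq> {1..n}"
    by (auto simp: is_group_def)
  have "A j i' = A j i" if "j \<in> I" "i' \<in> S" for j i'
  proof -
    from that S obtain c where "\<forall>i\<in>S. c \<in> A j i"
      by (auto simp: agreement_rounds_def)
    with eq that i sub show ?thesis by blast
  qed
  then have "represented_rounds I A W S = approved_rounds I A W i"
    using i by (auto simp: represented_rounds_def approved_rounds_def)
  moreover have "card (represented_rounds I A W S) \<ge> l"
    using S assms(2) unfolding wPJR_def by blast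
  ultimately show "\<exists>i\<in>S. card (approved_rounds I A W i) \<ge> l"
    using i by auto
qed

lemma cand_rank_le_card:
  assumes "finite C" "strict_ranking C R" "c \<in> C"
  shows "cand_rank C R c \<le> card C"
proof -
  have "card {c'\<in>C. R c' c} < card C"
    using assms by (intro psubset_card_mono) (auto simp: strict_ranking_def irreflp_on_def)
  then show ?thesis by (simp add: cand_rank_def)
qed

text \<open>Of two distinct candidates, one is preferred to the other, which then has rank at least
  two.\<close>

lemma top_cands_one_unique:
  assumes "finite C" "strict_ranking C R" "c \<in> top_cands C R 1" "d \<in> top_cands C R 1"
  shows "c = d"
proof (rule ccontr)
  assume "c \<noteq> d"
  with assms have "R c d \<or> R d c"
    by (auto simp: top_cands_def strict_ranking_def totalp_on_def)
  with assms show False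
    by (auto simp: top_cands_def cand_rank_def)
qed

text \<open>A cutoff that approves something is either one, where each voter approves a single
  candidate and the common one settles it, or at least \<open>card C\<close>, where everything is
  approved.\<close>

lemma top_cands_eq_if_common:
  assumes "finite C" "card C \<le> 2" "strict_ranking C R" "strict_ranking C R'"
    and c: "c \<in> top_cands C R r" "c \<in> top_cands C R' r"
  shows "top_cands C R r = top_cands C R' r"
proof -
  have "r \<ge> 1"
    using c by (auto simp: top_cands_def cand_rank_def)
  then consider "r = 1" | "r \<ge> card C"
    using assms(2) by linarith
  then show ?thesis
  proof cases
    case 1
    have "top_cands C Q r = {c}" if "strict_ranking C Q" "c \<in> top_cands C Q r" for Q
      using top_cands_one_unique[OF assms(1) that(1)] that(2) unfolding 1 by blast
    with assms(3,4) c show ?thesis by metis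
  next
    case 2
    have "top_cands C Q r = C" if Q: "strict_ranking C Q" for Q
      unfolding top_cands_def
      using cand_rank_le_card[OF assms(1) Q, THEN order_trans, OF _ 2] by blast
    with assms(3,4) show ?thesis by simp
  qed
qed

text \<open>A cutoff \<open>r\<close> depending on the round covers rank vectors and, as a constant
  function, fixed ranks; an arbitrary \<open>I\<close> covers the full horizon and all
  intervals.\<close>

lemma wEJR_iff_wPJR_two_cands:
  assumes P: "is_profile n C T P" "card C \<le> 2" and I: "I \<subseteq> {1..T}"
  shows "wEJR n C I (\<lambda>j i. top_cands C (P j i) (r j)) W \<longleftrightarrow>
         wPJR n C I (\<lambda>j i. top_cands C (P j i) (r j)) W"
proof
  show "wEJR n C I (\<lambda>j i. top_cands C (P j i) (r j)) W \<Longrightarrow>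
        wPJR n C I (\<lambda>j i. top_cands C (P j i) (r j)) W"
    using I finite_subset by (intro wEJR_imp_wPJR) auto
next
  show "wPJR n C I (\<lambda>j i. top_cands C (P j i) (r j)) W \<Longrightarrow>
        wEJR n C I (\<lambda>j i. top_cands C (P j i) (r j)) W"
  proof (rule wPJR_imp_wEJR)
    fix j i i' c
    assume ji: "j \<in> I" "i \<in> {1..n}" "i' \<in> {1..n}"
      and c: "c \<in> top_cands C (P j i) (r j)" "c \<in> top_cands C (P j i') (r j)"
    from ji have "finite C" "strict_ranking C (P j i)" "strict_ranking C (P j i')"
      using P(1) I unfolding is_profile_def by blast+
    then show "top_cands C (P j i) (r j) = top_cands C (P j i') (r j)"
      using P(2) c by (intro top_cands_eq_if_common)
  qed
qed

lemma rank_axioms_two_cands: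
  assumes "is_profile n C T P" "card C \<le> 2" "I \<subseteq> {1..T}"
  shows "rank_vector wEJR n C P I W \<longleftrightarrow> rank_vector wPJR n C P I W"
    and "fixed_rank wEJR n C P I W \<longleftrightarrow> fixed_rank wPJR n C P I W"
  using wEJR_iff_wPJR_two_cands[OF assms, where W = W]
    wEJR_iff_wPJR_two_cands[OF assms, where W = W and r = "\<lambda>_. r" for r]
  unfolding rank_vector_def fixed_rank_def by simp_all

section \<open>Comparison of the axioms, and wEJR for the largest and the smallest groups\<close>

lemma EJR_imp_wEJR: "EJR n C I A W \<Longrightarrow> wEJR n C I A W"
  unfolding EJR_def wEJR_def by metis

lemma fixed_rank_mono:
  assumes "\<And>A. X n C I A W \<Longrightarrow> Y n C I A W" "fixed_rank X n C P I W"
  shows "fixed_rank Y n C P I W"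
  using assms unfolding fixed_rank_def by blast

lemma rank_vector_imp_fixed_rank: "rank_vector X n C P I W \<Longrightarrow> fixed_rank X n C P I W"
  by (simp add: rank_vector_def fixed_rank_def)

lemma all_rank_imp_rank_vector: "all_rank X n C P I W \<Longrightarrow> rank_vector X n C P I W"
  by (simp add: rank_vector_def all_rank_def)

text \<open>The group of all voters meets the size bound with \<open>l = T\<close>, since
  \<open>T * n / T = n\<close>; approving \<open>T\<close> winners means approving all of
  them.\<close>

lemma wEJR_all_agree:
  assumes "wEJR n C {1..T} A W" "n \<ge> 1" "T \<ge> 1"
    and "\<And>j. j \<in> {1..T} \<Longrightarrow> \<exists>c\<in>C. \<forall>i\<in>{1..n}. c \<in> A j i"
  shows "\<exists>i\<in>{1..n}. \<forall>j\<in>{1..T}. W j \<in> A j i"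
proof -
  have "agreement_rounds C {1..T} A {1..n} = {1..T}"
    using assms(4) by (auto simp: agreement_rounds_def)
  then obtain i where i: "i \<in> {1..n}" "card (approved_rounds {1..T} A W i) \<ge> T"
    using assms(1)[unfolded wEJR_def, rule_format, of T "{1..n}"] assms(2,3)
    by (auto simp: is_group_def)
  have "approved_rounds {1..T} A W i = {1..T}"
    using i(2) by (intro card_seteq) (auto simp: approved_rounds_def)
  with i(1) show ?thesis
    by (intro bexI[of _ i]) (auto simp: approved_rounds_def)
qed

text \<open>A nonempty approval set makes a lone voter agree with herself, and
  \<open>T \<ge> n\<close> is the size bound for a singleton with \<open>l = 1\<close>.\<close>

lemma wEJR_single_voter:
  assumes "wEJR n C {1..T} A W" "i \<in> {1..n}" "T \<ge> n"
    and "\<And>j. j \<in> {1..T} \<Longrightarrow> A j i \<inter> C \<noteq> {}"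
  shows "\<exists>j\<in>{1..T}. W j \<in> A j i"
proof -
  have "agreement_rounds C {1..T} A {i} = {1..T}"
    using assms(4) by (fastforce simp: agreement_rounds_def)
  then have "card (approved_rounds {1..T} A W i) \<ge> 1"
    using assms(1)[unfolded wEJR_def, rule_format, of 1 "{i}"] assms(2,3)
    by (auto simp: is_group_def)
  then have "approved_rounds {1..T} A W i \<noteq> {}"
    by fastforce
  then show ?thesis
    by (auto simp: approved_rounds_def)
qed

section \<open>Profiles with opposite rankings\<close>

definition opposed :: "nat profile" where
  "opposed j i = (if i = 1 then (<) else (>))"

text \<open>Candidate \<open>c\<close> has rank \<open>c + 1\<close> for voter 1 and
  \<open>m - c\<close> for every other voter; \<open>m \<le> c + r\<close> states the latter bound
  without truncated subtraction.\<close>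

lemma top_cands_opposed:
  "top_cands {..<m} (opposed j i) r =
     (if i = 1 then {c. c < m \<and> c < r} else {c. c < m \<and> m \<le> c + r})"
proof -
  have "{c'\<in>{..<m}. c' < c} = {..<c}" "{c'\<in>{..<m}. c < c'} = {c<..<m}" if "c < m" for c :: nat
    using that by auto
  then show ?thesis
    by (auto simp: top_cands_def cand_rank_def opposed_def)
qed

lemma is_profile_opposed: "n \<ge> 1 \<Longrightarrow> m \<ge> 1 \<Longrightarrow> T \<ge> 1 \<Longrightarrow> is_profile n {..<m} T opposed"
  by (auto simp: is_profile_def strict_ranking_def opposed_def irreflp_on_def transp_on_def totalp_on_def)

lemma static_profile_opposed: "static_profile n C T opposed"
  by (simp add: static_profile_def opposed_def)

lemma single_peaked_opposed:
  assumes "m \<ge> 1"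
  shows "common_axis_single_peaked n {..<m} T opposed"
  unfolding common_axis_single_peaked_def
proof (intro exI[of _ "(<)"] conjI ballI)
  show "strict_ranking {..<m} ((<) :: nat \<Rightarrow> nat \<Rightarrow> bool)"
    by (auto simp: strict_ranking_def irreflp_on_def transp_on_def totalp_on_def)
  show "single_peaked_on {..<m} (<) (opposed j i)" for j i
    unfolding single_peaked_on_def opposed_def
    \<comment> \<open>Both rankings are monotone along the axis, so the peaks are its two
      ends.\<close>
    using assms by (intro bexI[of _ "if i = 1 then 0 else m - 1"]) auto
qed

lemma strict_euclidean_opposed: "strict_euclidean 2 {..<2} T opposed"
  unfolding strict_euclidean_def
proof
  fix j
  \<comment> \<open>Candidate \<open>c\<close> is placed at \<open>c\<close> and voter
    \<open>i\<close> at \<open>i - 1\<close>, on top of her favourite, so the distances are zero and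
    one.\<close>
  have "\<forall>i\<in>{1..2}. \<forall>c\<in>{..<2::nat}. \<forall>d\<in>{..<2}.
    (c \<noteq> d \<longrightarrow> \<bar>(real i - 1) - real c\<bar> \<noteq> \<bar>(real i - 1) - real d\<bar>) \<and>
    (opposed j i c d \<longleftrightarrow> \<bar>(real i - 1) - real c\<bar> < \<bar>(real i - 1) - real d\<bar>)"
    by (auto simp: opposed_def less_2_cases_iff le_Suc_eq numeral_2_eq_2)
  then show "\<exists>(x::nat \<Rightarrow> real) (y::nat \<Rightarrow> real). \<forall>i\<in>{1..2}. \<forall>c\<in>{..<2::nat}. \<forall>d\<in>{..<2}.
    (c \<noteq> d \<longrightarrow> \<bar>x i - y c\<bar> \<noteq> \<bar>x i - y d\<bar>) \<and>
    (opposed j i c d \<longleftrightarrow> \<bar>x i - y c\<bar> < \<bar>x i - y d\<bar>)"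
    by (intro exI[of _ "\<lambda>i. real i - 1"] exI[of _ real])
qed

text \<open>With cutoff one, voter 1 approves only \<open>0\<close> and voter 2 only
  \<open>m - 1\<close>; two rounds suffice for each of them to be owed a winner.\<close>

lemma rank_one_favourites_win:
  assumes "wEJR 2 {..<m} {1..T} (\<lambda>j i. top_cands {..<m} (opposed j i) 1) W"
    and "T \<ge> 2" "m \<ge> 1"
  obtains j j' where "j \<in> {1..T}" "W j = 0" "j' \<in> {1..T}" "W j' = m - 1"
proof -
  have "\<exists>j\<in>{1..T}. W j \<in> top_cands {..<m} (opposed j i) 1" if "i \<in> {1..2}" for i
  proof (rule wEJR_single_voter[OF assms(1) that \<open>T \<ge> 2\<close>])
    show "top_cands {..<m} (opposed j i) 1 \<inter> {..<m} \<noteq> {}" for j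
      using \<open>m \<ge> 1\<close> top_cands_opposed[of m j i 1]
      by (cases "i = 1") (auto simp: set_eq_iff intro: exI[of _ 0] exI[of _ "m - 1"])
  qed
  from this[of 1] this[of 2] obtain j j' where
    "j \<in> {1..T}" "W j \<in> top_cands {..<m} (opposed j 1) 1"
    "j' \<in> {1..T}" "W j' \<in> top_cands {..<m} (opposed j' 2) 1"
    by auto
  then show thesis
    by (intro that[of j j']) (auto simp: top_cands_opposed)
qed

lemma no_fixed_rank_wEJR_opposed:
  assumes "T \<ge> 2"
  shows "\<not> fixed_rank wEJR 2 {..<3} opposed {1..T} W"
proof
  assume "fixed_rank wEJR 2 {..<3} opposed {1..T} W"
  then have W: "wEJR 2 {..<3} {1..T} (\<lambda>j i. top_cands {..<3} (opposed j i) r) W"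
    if "r \<in> {1..3}" for r
    using that by (simp add: fixed_rank_def)
  obtain j j' where j: "j \<in> {1..T}" "W j = 0" "j' \<in> {1..T}" "W j' = 2"
    using rank_one_favourites_win[OF W assms] by auto
  have "\<exists>c\<in>{..<3}. \<forall>i\<in>{1..2}. c \<in> top_cands {..<3} (opposed j i) 2" for j
    \<comment> \<open>Both voters rank the middle candidate second.\<close>
    by (intro bexI[of _ 1]) (auto simp: top_cands_opposed)
  then have "\<exists>i\<in>{1..2}. \<forall>j\<in>{1..T}. W j \<in> top_cands {..<3} (opposed j i) 2"
    using W[of 2] assms by (intro wEJR_all_agree) auto
  then obtain i where "\<forall>j\<in>{1..T}. W j \<in> top_cands {..<3} (opposed j i) 2"
    by blast
  with j have "W j \<in> top_cands {..<3} (opposed j i) 2" "W j' \<in> top_cands {..<3} (opposed j' i) 2"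
    by blast+
  \<comment> \<open>At cutoff two, voter 1 rejects \<open>2\<close> and any other voter rejects
    \<open>0\<close>, yet both candidates win somewhere.\<close>
  with j show False
    by (auto simp: top_cands_opposed split: if_splits)
qed

text \<open>Fixed-rank-wEJR is the weakest of the six axioms: EJR contains wEJR, and a fixed rank is
  a constant rank vector, which in turn is a rank matrix constant across voters.\<close>

lemma no_cutoff_wEJR_opposed:
  assumes "X \<in> {EJR, wEJR}"
  shows "\<not> fixed_rank X 2 {..<3} opposed {1..2} W"
    and "\<not> rank_vector X 2 {..<3} opposed {1..2} W"
    and "\<not> all_rank X 2 {..<3} opposed {1..2} W"
proof -
  show "\<not> fixed_rank X 2 {..<3} opposed {1..2} W"
    using assms no_fixed_rank_wEJR_opposed[of 2 W]
      fixed_rank_mono[of EJR 2 "{..<3}" "{1..2}" W wEJR, OF EJR_imp_wEJR]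
    by auto
  then show "\<not> rank_vector X 2 {..<3} opposed {1..2} W"
    using rank_vector_imp_fixed_rank by blast
  then show "\<not> all_rank X 2 {..<3} opposed {1..2} W"
    using all_rank_imp_rank_vector by blast
qed

lemma no_all_rank_wEJR_opposed:
  assumes "T \<ge> 2" "winner_sequence {..<2} T W"
  shows "\<not> all_rank wEJR 2 {..<2} opposed {1..T} W"
proof
  assume all: "all_rank wEJR 2 {..<2} opposed {1..T} W"
  then have "wEJR 2 {..<2} {1..T} (\<lambda>j i. top_cands {..<2} (opposed j i) 1) W"
    using all_rank_imp_rank_vector rank_vector_imp_fixed_rank
    by (fastforce simp: fixed_rank_def)
  then obtain j j' where j: "j \<in> {1..T}" "W j = 0" "j' \<in> {1..T}" "W j' = 1"
    using assms(1) by (elim rank_one_favourites_win) auto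
  \<comment> \<open>The favourite of voter \<open>i\<close> is \<open>i - 1\<close>. If it wins
    round \<open>j\<close>, she approves everything; otherwise she approves only it.\<close>
  define R where "R j i = (if W j = i - 1 then 2 else 1 :: nat)" for j i :: nat
  have "wEJR 2 {..<2} {1..T} (\<lambda>j i. top_cands {..<2} (opposed j i) (R j i)) W"
    using all by (simp add: all_rank_def R_def)
  moreover have "\<exists>c\<in>{..<2}. \<forall>i\<in>{1..2}. c \<in> top_cands {..<2} (opposed j i) (R j i)"
    if "j \<in> {1..T}" for j
  proof (intro bexI ballI)
    have "W j < 2"
      using assms(2) that by (auto simp: winner_sequence_def)
    \<comment> \<open>The losing candidate is the favourite of the voter with cutoff one, and the
      other voter approves both candidates.\<close>
    then show "1 - W j \<in> top_cands {..<2} (opposed j i) (R j i)" if "i \<in> {1..2}" for i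
      using that by (auto simp: top_cands_opposed R_def)
  qed auto
  ultimately have "\<exists>i\<in>{1..2}. \<forall>j\<in>{1..T}. W j \<in> top_cands {..<2} (opposed j i) (R j i)"
    using assms(1) by (intro wEJR_all_agree) auto
  then obtain i where i: "i \<in> {1..2}"
    "\<forall>j\<in>{1..T}. W j \<in> top_cands {..<2} (opposed j i) (R j i)"
    by blast
  with j have "W j \<in> top_cands {..<2} (opposed j i) (R j i)"
    "W j' \<in> top_cands {..<2} (opposed j' i) (R j' i)"
    by blast+
  \<comment> \<open>Voter 2 rejects the winner \<open>0\<close> of round \<open>j\<close>, and voter
    1 the winner \<open>1\<close> of round \<open>j'\<close>.\<close>
  with i(1) j show False
    by (auto simp: top_cands_opposed R_def split: if_splits)
qed

theorem theorem3p4: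
  shows
    "(\<forall>T\<ge>2. \<exists>(C::nat set) P.
        is_profile 2 C T P \<and> card C = 3 \<and> static_profile 2 C T P \<and>
        common_axis_single_peaked 2 C T P \<and>
        \<not> (\<exists>W. winner_sequence C T W \<and> fixed_rank wEJR 2 C P {1..T} W))
   \<and> (\<forall>cutoff\<in>{fixed_rank, rank_vector, all_rank}. \<forall>X\<in>{EJR, wEJR}.
        \<exists>n (C::nat set) T P.
          is_profile n C T P \<and>
          \<not> (\<exists>W. winner_sequence C T W \<and> cutoff X n C P {1..T} W))
   \<and> (\<forall>n (C::'c set) T P W.
        is_profile n C T P \<and> card C \<le> 2 \<and> winner_sequence C T W \<longrightarrow>
          (rank_vector wEJR n C P {1..T} W \<longleftrightarrow> rank_vector wPJR n C P {1..T} W) \<and>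
          (fixed_rank wEJR n C P {1..T} W \<longleftrightarrow> fixed_rank wPJR n C P {1..T} W) \<and>
          (\<forall>a b. 1 \<le> a \<and> a \<le> b \<and> b \<le> T \<longrightarrow>
             (rank_vector wEJR n C P {a..b} W \<longleftrightarrow> rank_vector wPJR n C P {a..b} W) \<and>
             (fixed_rank wEJR n C P {a..b} W \<longleftrightarrow> fixed_rank wPJR n C P {a..b} W)))
   \<and> (\<forall>T\<ge>2. \<exists>(C::nat set) P.
        is_profile 2 C T P \<and> card C = 2 \<and> static_profile 2 C T P \<and>
        strict_euclidean 2 C T P \<and>
        \<not> (\<exists>W. winner_sequence C T W \<and> all_rank wEJR 2 C P {1..T} W))"
proof (intro conjI)
  show "\<forall>T\<ge>2. \<exists>(C::nat set) P.
        is_profile 2 C T P \<and> card C = 3 \<and> static_profile 2 C T P \<and>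
        common_axis_single_peaked 2 C T P \<and>
        \<not> (\<exists>W. winner_sequence C T W \<and> fixed_rank wEJR 2 C P {1..T} W)"
    using no_fixed_rank_wEJR_opposed
    by (intro allI impI exI[of _ "{..<3}"] exI[of _ opposed])
      (auto simp: is_profile_opposed static_profile_opposed single_peaked_opposed)
  show "\<forall>cutoff\<in>{fixed_rank, rank_vector, all_rank}. \<forall>X\<in>{EJR, wEJR}.
        \<exists>n (C::nat set) T P.
          is_profile n C T P \<and>
          \<not> (\<exists>W. winner_sequence C T W \<and> cutoff X n C P {1..T} W)"
    using no_cutoff_wEJR_opposed
    by (intro ballI exI[of _ 2] exI[of _ "{..<3}"] exI[of _ opposed])
      (auto simp: is_profile_opposed)
  show "\<forall>n (C::'c set) T P W.
        is_profile n C T P \<and> card C \<le> 2 \<and> winner_sequence C T W \<longrightarrow>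
          (rank_vector wEJR n C P {1..T} W \<longleftrightarrow> rank_vector wPJR n C P {1..T} W) \<and>
          (fixed_rank wEJR n C P {1..T} W \<longleftrightarrow> fixed_rank wPJR n C P {1..T} W) \<and>
          (\<forall>a b. 1 \<le> a \<and> a \<le> b \<and> b \<le> T \<longrightarrow>
             (rank_vector wEJR n C P {a..b} W \<longleftrightarrow> rank_vector wPJR n C P {a..b} W) \<and>
             (fixed_rank wEJR n C P {a..b} W \<longleftrightarrow> fixed_rank wPJR n C P {a..b} W))"
  proof (intro allI impI, elim conjE)
    fix n T W and C :: "'c set" and P
    assume "is_profile n C T P" "card C \<le> 2"
    note eq = rank_axioms_two_cands[OF this, where W = W]
    show "(rank_vector wEJR n C P {1..T} W \<longleftrightarrow> rank_vector wPJR n C P {1..T} W) \<and>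
          (fixed_rank wEJR n C P {1..T} W \<longleftrightarrow> fixed_rank wPJR n C P {1..T} W) \<and>
          (\<forall>a b. 1 \<le> a \<and> a \<le> b \<and> b \<le> T \<longrightarrow>
             (rank_vector wEJR n C P {a..b} W \<longleftrightarrow> rank_vector wPJR n C P {a..b} W) \<and>
             (fixed_rank wEJR n C P {a..b} W \<longleftrightarrow> fixed_rank wPJR n C P {a..b} W))"
      using eq[of "{1..T}"] eq[of "{a..b}" for a b] by simp
  qed
  show "\<forall>T\<ge>2. \<exists>(C::nat set) P.
        is_profile 2 C T P \<and> card C = 2 \<and> static_profile 2 C T P \<and>
        strict_euclidean 2 C T P \<and>
        \<not> (\<exists>W. winner_sequence C T W \<and> all_rank wEJR 2 C P {1..T} W)"
    using no_all_rank_wEJR_opposed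
    by (intro allI impI exI[of _ "{..<2}"] exI[of _ opposed])
      (auto simp: is_profile_opposed static_profile_opposed strict_euclidean_opposed)
qed

end
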